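(* Let $\ell\ge2$, let $b^\ell_k$ be the number of $\ell$-partitions whose first part equals $k$, and let $B_\ell(x)=\sum_{k=0}^\infty b^\ell_k x^k$. Then $$B_\ell(x)=\frac{1-x^{\ell-1}}{(1-x)^{\ell-1}\,(1-x^{\ell-1}-x^{\ell})}.$$
   Context: The empty partition is the unique partition with first part $0$. A partition is $\ell$-regular if it does not have $\ell$ or more equal nonzero parts. A removable $\ell$-rim hook (for short, $\ell$-rim hook) of $\lambda$ is a connected sequence of $\ell$ boxes of the Young diagram of $\lambda$, containing no $2\times2$ square, whose removal from $\lambda$ leaves the Young diagram of a partition. It is horizontal if all its boxes lie in one row, and non-horizontal otherwise. An $\ell$-partition is an $\ell$-regular partition (of any size) which has no non-horizontal $\ell$-rim hooks and such that, after removing any number of horizontal $\ell$-rim hooks in any order, the remaining diagram has no non-horizontal $\ell$-rim hooks. The identity is one of formal power series. *)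

theory Defs
  imports "HOL-Computational_Algebra.Formal_Power_Series"
begin

text \<open>A partition is the list of its nonzero parts in weakly decreasing order, so the empty
  partition is the empty list.\<close>

definition is_partition :: "nat list \<Rightarrow> bool" where
  "is_partition p \<longleftrightarrow> sorted_wrt (\<ge>) p \<and> 0 \<notin> set p"

definition first_part :: "nat list \<Rightarrow> nat" where
  "first_part p = (case p of [] \<Rightarrow> 0 | a # _ \<Rightarrow> a)"

definition regular_partition :: "nat \<Rightarrow> nat list \<Rightarrow> bool" where
  "regular_partition l p \<longleftrightarrow> is_partition p \<and> (\<forall>a\<in>set p. count_list p a < l)"

text \<open>Boxes are pairs (row, column), both counted from 0.\<close>

type_synonym box = "nat \<times> nat"

definition young_diagram :: "nat list \<Rightarrow> box set" where
  "young_diagram p = {(i, j). i < length p \<and> j < p ! i}"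

definition adjacent :: "box \<Rightarrow> box \<Rightarrow> bool" where
  "adjacent a b \<longleftrightarrow>
     (fst a = fst b \<and> (snd b = Suc (snd a) \<or> snd a = Suc (snd b))) \<or>
     (snd a = snd b \<and> (fst b = Suc (fst a) \<or> fst a = Suc (fst b)))"

definition connected_boxes :: "box set \<Rightarrow> bool" where
  "connected_boxes R \<longleftrightarrow>
     (\<forall>a\<in>R. \<forall>b\<in>R. (\<lambda>x y. x \<in> R \<and> y \<in> R \<and> adjacent x y)\<^sup>*\<^sup>* a b)"

definition contains_2x2 :: "box set \<Rightarrow> bool" where
  "contains_2x2 R \<longleftrightarrow> (\<exists>i j. {(i, j), (i, Suc j), (Suc i, j), (Suc i, Suc j)} \<subseteq> R)"

definition rim_hook_removal :: "nat \<Rightarrow> nat list \<Rightarrow> box set \<Rightarrow> nat list \<Rightarrow> bool" where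
  "rim_hook_removal l p R q \<longleftrightarrow>
     R \<subseteq> young_diagram p \<and> card R = l \<and> connected_boxes R \<and> \<not> contains_2x2 R \<and>
     is_partition q \<and> young_diagram q = young_diagram p - R"

definition rim_hook :: "nat \<Rightarrow> nat list \<Rightarrow> box set \<Rightarrow> bool" where
  "rim_hook l p R \<longleftrightarrow> (\<exists>q. rim_hook_removal l p R q)"

definition horizontal :: "box set \<Rightarrow> bool" where
  "horizontal R \<longleftrightarrow> (\<exists>i. \<forall>b\<in>R. fst b = i)"

definition remove_horizontal :: "nat \<Rightarrow> nat list \<Rightarrow> nat list \<Rightarrow> bool" where
  "remove_horizontal l p q \<longleftrightarrow> (\<exists>R. horizontal R \<and> rim_hook_removal l p R q)"

definition has_nonhorizontal_rim_hook :: "nat \<Rightarrow> nat list \<Rightarrow> bool" where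
  "has_nonhorizontal_rim_hook l p \<longleftrightarrow> (\<exists>R. rim_hook l p R \<and> \<not> horizontal R)"

text \<open>The reflexive closure accounts for the case of no removals, i.e. for the condition on
  \<open>p\<close> itself. Regularity is only required of \<open>p\<close>, not of the partitions reached from it.\<close>

definition l_partition :: "nat \<Rightarrow> nat list \<Rightarrow> bool" where
  "l_partition l p \<longleftrightarrow>
     regular_partition l p \<and>
     (\<forall>q. (remove_horizontal l)\<^sup>*\<^sup>* p q \<longrightarrow> \<not> has_nonhorizontal_rim_hook l q)"

definition num_l_partitions :: "nat \<Rightarrow> nat \<Rightarrow> nat" where
  "num_l_partitions l k = card {p. l_partition l p \<and> first_part p = k}"

definition l_partition_fps :: "nat \<Rightarrow> rat fps" where
  "l_partition_fps l = Abs_fps (\<lambda>k. of_nat (num_l_partitions l k))"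

end

theory Submission imports Defs "HOL-Library.Infinite_Set" begin

text \<open>
  Call a partition good if no sequence of horizontal removals leads to a non-horizontal hook, and a
  core if it has no \<open>l\<close>-rim hooks at all. Compare the first two rows of a good partition with
  first part \<open>k\<close>. If they differ by at least \<open>l\<close>, shortening the first row by \<open>l\<close> is a bijection onto
  the good partitions with first part \<open>k - l\<close>. If they differ by exactly \<open>l - 1\<close>, deleting the first
  row is a bijection onto the good partitions with first part \<open>k - (l - 1)\<close>. If they differ by less, no
  row can be shortened, so the partition is a core. Cores satisfy the analogous recursion
  without the first case. Eliminating the remaining term gives
  \<open>B (1 - x\<^sup>l\<^sup>-\<^sup>1 - x\<^sup>l) = C (1 - x\<^sup>l\<^sup>-\<^sup>1)\<close>, where \<open>C\<close> counts cores by first part. A core is determined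
  by the numbers of gaps on the \<open>l - 1\<close> other runners of its abacus below the largest bead, which are
  arbitrary with sum \<open>k\<close>, so \<open>C = 1 / (1 - x)\<^sup>l\<^sup>-\<^sup>1\<close>.
\<close>

section \<open>Horizontal removals on row sequences\<close>

text \<open>Partitions are handled as sequences of row lengths, continued by zeros. The condition in
  \<open>bent\<close> says in terms of the beta numbers \<open>f i - i\<close> that the one of row \<open>i\<close>, decreased by \<open>l\<close>, lies
  strictly between those of the rows \<open>j\<close> and \<open>Suc j\<close>, i.e. that there is an \<open>l\<close>-rim hook occupying
  the rows \<open>i, \<dots>, j\<close>.\<close>

definition row_seqs :: "(nat \<Rightarrow> nat) set" where
  "row_seqs = {f. antimono f \<and> (\<exists>n. f n = 0)}"

text \<open>A horizontal \<open>l\<close>-rim hook consists of the last \<open>l\<close> boxes of a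
  row, and what is left is a partition when the next row is shorter by at least
  \<open>l\<close>.\<close>

definition step :: "nat \<Rightarrow> (nat \<Rightarrow> nat) \<Rightarrow> (nat \<Rightarrow> nat) \<Rightarrow> bool" where
  "step l f g \<longleftrightarrow> (\<exists>i. f (Suc i) + l \<le> f i \<and> g = f(i := f i - l))"

definition bent :: "nat \<Rightarrow> (nat \<Rightarrow> nat) \<Rightarrow> bool" where
  "bent l f \<longleftrightarrow> (\<exists>i j. i < j \<and> f i + j < l + i + f j \<and> f (Suc j) + l + i \<le> f i + j)"

definition good :: "nat \<Rightarrow> (nat \<Rightarrow> nat) \<Rightarrow> bool" where
  "good l f \<longleftrightarrow> (\<forall>g. (step l)\<^sup>*\<^sup>* f g \<longrightarrow> \<not> bent l g)"

definition core :: "nat \<Rightarrow> (nat \<Rightarrow> nat) \<Rightarrow> bool" where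
  "core l f \<longleftrightarrow> \<not> bent l f \<and> (\<forall>i. f i < f (Suc i) + l)"

lemma row_seqs_Suc: "f \<in> row_seqs \<Longrightarrow> f (Suc i) \<le> f i"
  by (auto simp: row_seqs_def antimono_def)

lemma row_seqs_mono: "f \<in> row_seqs \<Longrightarrow> i \<le> j \<Longrightarrow> f j \<le> f i"
  by (auto simp: row_seqs_def antimono_def)

lemma row_seqsI:
  assumes "\<And>i. f (Suc i) \<le> f i" "f n = 0"
  shows "f \<in> row_seqs"
  using assms by (auto simp: row_seqs_def antimono_iff_le_Suc)

lemma row_seqs_step:
  assumes "f \<in> row_seqs" "step l f g"
  shows "g \<in> row_seqs"
proof -
  obtain i where i: "f (Suc i) + l \<le> f i" "g = f(i := f i - l)"
    using assms by (auto simp: step_def)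
  obtain n where n: "f n = 0" using assms by (auto simp: row_seqs_def)
  show ?thesis
  proof (rule row_seqsI)
    show "g n = 0" using i n by auto
    fix m show "g (Suc m) \<le> g m"
      using i row_seqs_Suc[OF assms(1), of m] by (auto simp: le_diff_conv)
  qed
qed

text \<open>\<open>good\<close> is the greatest predicate that excludes \<open>bent\<close> and is
  preserved by \<open>step\<close>, so any invariant with these two properties implies it.\<close>

lemma good_coinduct:
  assumes "X f"
    and "\<And>f. X f \<Longrightarrow> \<not> bent l f"
    and "\<And>f g. X f \<Longrightarrow> step l f g \<Longrightarrow> X g"
  shows "good l f"
proof -
  have "X g" if "(step l)\<^sup>*\<^sup>* f g" for g
    using that by (induction rule: rtranclp_induct) (use assms in blast)+
  then show ?thesis using assms(2) by (auto simp: good_def)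
qed

lemma good_not_bent: "good l f \<Longrightarrow> \<not> bent l f"
  by (auto simp: good_def)

lemma good_step: "good l f \<Longrightarrow> step l f g \<Longrightarrow> good l g"
  by (auto simp: good_def intro: converse_rtranclp_into_rtranclp)

text \<open>No row of a core can be shortened, so preservation of \<open>core\<close> under
  \<open>step\<close> holds vacuously.\<close>

lemma core_good:
  assumes "core l f" shows "good l f"
proof (rule good_coinduct[where X = "core l"])
  show "core l g" if "core l h" "step l h g" for g h
    using that by (fastforce simp: core_def step_def dest: leD)
qed (use assms in \<open>auto simp: core_def\<close>)

lemma bent_tail: "bent l (\<lambda>i. f (Suc i)) \<Longrightarrow> bent l f"
  unfolding bent_def
proof (elim exE conjE)
  fix i j assume "i < j" "f (Suc i) + j < l + i + f (Suc j)" "f (Suc (Suc j)) + l + i \<le> f (Suc i) + j"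
  then show "\<exists>i j. i < j \<and> f i + j < l + i + f j \<and> f (Suc j) + l + i \<le> f i + j"
    by (intro exI[of _ "Suc i"] exI[of _ "Suc j"]) simp
qed

lemma bent_cases:
  assumes "bent l f"
  obtains "bent l (\<lambda>i. f (Suc i))"
  | j where "j > 0" "f 0 + j < l + f j" "f (Suc j) + l \<le> f 0 + j"
proof -
  obtain i j where ij: "i < j" "f i + j < l + i + f j" "f (Suc j) + l + i \<le> f i + j"
    using assms by (auto simp: bent_def)
  show ?thesis
  proof (cases i)
    case 0 then show ?thesis using ij that(2)[of j] by simp
  next
    case (Suc i')
    then obtain j' where "j = Suc j'" using ij by (cases j) auto
    then have "bent l (\<lambda>i. f (Suc i))" using ij Suc unfolding bent_def
      by (intro exI[of _ i'] exI[of _ j']) simp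
    then show ?thesis by (rule that(1))
  qed
qed

text \<open>A hook that is not present in the tail starts in row \<open>0\<close> and ends in some
  row \<open>j \<ge> 1\<close>. Its first inequality \<open>f 0 + j < l + f j\<close> gives the
  bound because \<open>f j \<le> f 1\<close>.\<close>

lemma bent_top:
  assumes "f \<in> row_seqs" "bent l f" "\<not> bent l (\<lambda>i. f (Suc i))"
  shows "Suc (f 0) < l + f 1"
  using assms(2)
proof (cases rule: bent_cases)
  case 1 then show ?thesis using assms by simp
next
  case (2 j)
  have "f j \<le> f 1" using 2 by (intro row_seqs_mono[OF assms(1)]) simp
  then show ?thesis using 2 by simp
qed

lemma step_tail:
  "step l (\<lambda>i. f (Suc i)) g \<Longrightarrow> step l f (case_nat (f 0) g)"
  by (fastforce simp: step_def fun_eq_iff split: nat.splits)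

lemma step_cases:
  assumes "step l f g"
  obtains "f 1 + l \<le> f 0" "g = f(0 := f 0 - l)"
  | "g 0 = f 0" "step l (\<lambda>i. f (Suc i)) (\<lambda>i. g (Suc i))"
proof -
  obtain i where i: "f (Suc i) + l \<le> f i" "g = f(i := f i - l)"
    using assms by (auto simp: step_def)
  show ?thesis
  proof (cases i)
    case 0 then show ?thesis using i that(1) by simp
  next
    case (Suc j)
    have "step l (\<lambda>i. f (Suc i)) (\<lambda>i. g (Suc i))"
      unfolding step_def using i Suc by (intro exI[of _ j]) auto
    then show ?thesis using i Suc by (intro that(2)) auto
  qed
qed

text \<open>Every sequence of removals in the tail can be carried out below an unchanged top row
  \<open>a\<close>, and a bent tail makes the whole sequence bent.\<close>

lemma good_tail:
  assumes "good l f" shows "good l (\<lambda>i. f (Suc i))"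
proof (rule good_coinduct[where X = "\<lambda>g. \<exists>a. good l (case_nat a g)"])
  have "case_nat (f 0) (\<lambda>i. f (Suc i)) = f" by (auto split: nat.splits)
  then show "\<exists>a. good l (case_nat a (\<lambda>i. f (Suc i)))" using assms by metis
next
  fix g assume "\<exists>a. good l (case_nat a g)"
  then obtain a where "good l (case_nat a g)" by auto
  from good_not_bent[OF this] show "\<not> bent l g" using bent_tail[of l "case_nat a g"] by auto
next
  fix g h assume "\<exists>a. good l (case_nat a g)" and s: "step l g h"
  then obtain a where a: "good l (case_nat a g)" by auto
  have "step l (case_nat a g) (case_nat a h)"
    using step_tail[of l "case_nat a g" h] s by simp
  then show "\<exists>a. good l (case_nat a h)" using a good_step by blast
qed

lemma row_seqs_tail: "f \<in> row_seqs \<Longrightarrow> (\<lambda>i. f (Suc i)) \<in> row_seqs"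
proof -
  assume f: "f \<in> row_seqs"
  then obtain n where n: "f n = 0" by (auto simp: row_seqs_def)
  show ?thesis
    by (rule row_seqsI[of _ n]) (use n row_seqs_Suc[OF f, of n] row_seqs_Suc[OF f] in auto)
qed

lemma row_seqs_case_nat:
  assumes "f \<in> row_seqs" "f 0 \<le> a"
  shows "case_nat a f \<in> row_seqs"
proof -
  obtain n where "f n = 0" using assms by (auto simp: row_seqs_def)
  then show ?thesis
    by (intro row_seqsI[of _ "Suc n"]) (use assms row_seqs_Suc in \<open>auto split: nat.splits\<close>)
qed

lemma row_seqs_upd0:
  assumes "f \<in> row_seqs" "f 1 \<le> a"
  shows "f(0 := a) \<in> row_seqs"
proof -
  have "f(0 := a) = case_nat a (\<lambda>i. f (Suc i))" by (auto split: nat.splits)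
  then show ?thesis using row_seqs_case_nat[OF row_seqs_tail[OF assms(1)]] assms(2) by simp
qed

text \<open>A top row that exceeds the second one by \<open>l - 1\<close> modulo \<open>l\<close> never takes part in a
  non-horizontal hook, and horizontal removals preserve this congruence.\<close>

lemma good_congruent_top:
  assumes "f \<in> row_seqs" "l > 0" "good l (\<lambda>i. f (Suc i))" "f 0 = f 1 + (l - 1) + l * m"
  shows "good l f"
proof (rule good_coinduct[where X = "\<lambda>f. f \<in> row_seqs \<and> good l (\<lambda>i. f (Suc i)) \<and>
    (\<exists>m. f 0 = f 1 + (l - 1) + l * m)"])
  show "f \<in> row_seqs \<and> good l (\<lambda>i. f (Suc i)) \<and> (\<exists>m. f 0 = f 1 + (l - 1) + l * m)"
    using assms by auto
next
  fix f assume f: "f \<in> row_seqs \<and> good l (\<lambda>i. f (Suc i)) \<and> (\<exists>m. f 0 = f 1 + (l - 1) + l * m)"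
  then have "\<not> Suc (f 0) < l + f 1" using assms(2) by auto
  then show "\<not> bent l f" using bent_top f good_not_bent by blast
next
  fix f g assume f: "f \<in> row_seqs \<and> good l (\<lambda>i. f (Suc i)) \<and> (\<exists>m. f 0 = f 1 + (l - 1) + l * m)"
    and s: "step l f g"
  from f obtain m where m: "f 0 = f 1 + (l - 1) + l * m" by auto
  have g: "g \<in> row_seqs" using f s row_seqs_step by blast
  from s show "g \<in> row_seqs \<and> good l (\<lambda>i. g (Suc i)) \<and> (\<exists>m. g 0 = g 1 + (l - 1) + l * m)"
  proof (cases rule: step_cases)
    case 1
    then obtain m' where "m = Suc m'" using m assms(2) by (cases m) auto
    then have "g 0 = g 1 + (l - 1) + l * m'" using 1 m by simp
    then show ?thesis using g f 1 by auto
  next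
    case 2
    \<comment> \<open>The top row is unchanged here. The second row either loses \<open>l\<close>,
      which raises \<open>m\<close> by one, or stays as it is.\<close>
    have "\<exists>m. g 0 = g 1 + (l - 1) + l * m"
      using 2(2)
    proof (cases rule: step_cases)
      case 1
      then have "f 1 = g 1 + l" by (simp add: fun_eq_iff split: if_splits)
      then have "g 0 = g 1 + (l - 1) + l * Suc m" using 2(1) m by simp
      then show ?thesis by blast
    next
      case 2
      then show ?thesis using \<open>g 0 = f 0\<close> m by auto
    qed
    then show ?thesis using g f 2 good_step by blast
  qed
qed

text \<open>As long as the top row is not shortened, the sequence is a good one with its top row
  lengthened by \<open>l\<close>. The first removal in the top row undoes the lengthening and lands
  in that good sequence. The invariant is the disjunction of these two situations.\<close>

lemma good_enlarge_top:
  assumes "f \<in> row_seqs" "good l f"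
  shows "good l (f(0 := f 0 + l))"
proof (rule good_coinduct[where X = "\<lambda>g. good l g \<or> (\<exists>f\<in>row_seqs. good l f \<and> g = f(0 := f 0 + l))"])
  show "good l (f(0 := f 0 + l)) \<or> (\<exists>h\<in>row_seqs. good l h \<and> f(0 := f 0 + l) = h(0 := h 0 + l))"
    using assms by auto
next
  fix g assume "good l g \<or> (\<exists>f\<in>row_seqs. good l f \<and> g = f(0 := f 0 + l))"
  then show "\<not> bent l g"
  proof (elim disjE bexE conjE)
    fix f assume f: "f \<in> row_seqs" "good l f" and g: "g = f(0 := f 0 + l)"
    have le: "f 1 \<le> f 0" using row_seqs_Suc[OF f(1), of 0] by simp
    have "g \<in> row_seqs" unfolding g using f(1) le by (intro row_seqs_upd0) auto
    moreover have "\<not> bent l (\<lambda>i. g (Suc i))"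
      using good_not_bent[OF good_tail[OF f(2)]] g by simp
    \<comment> \<open>The lengthened top row exceeds the second one by at least \<open>l\<close>,
      too much for a non-horizontal hook to start in it.\<close>
    moreover have "\<not> Suc (g 0) < l + g 1" using g le by simp
    ultimately show ?thesis using bent_top by blast
  qed (rule good_not_bent)
next
  fix g h assume "good l g \<or> (\<exists>f\<in>row_seqs. good l f \<and> g = f(0 := f 0 + l))" and s: "step l g h"
  then show "good l h \<or> (\<exists>f\<in>row_seqs. good l f \<and> h = f(0 := f 0 + l))"
  proof (elim disjE bexE conjE)
    assume "good l g" then show ?thesis using s good_step by blast
  next
    fix f assume f: "f \<in> row_seqs" "good l f" and g: "g = f(0 := f 0 + l)"
    from s show ?thesis
    proof (cases rule: step_cases)
      case 1
      then have "h = f" using g by auto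
      then show ?thesis using f by simp
    next
      case 2
      \<comment> \<open>The same removal performed below the top row of \<open>f\<close> instead of
        the lengthened one.\<close>
      define f' where "f' = case_nat (f 0) (\<lambda>i. h (Suc i))"
      have "step l f f'" unfolding f'_def using 2 g by (intro step_tail) simp
      moreover have "h = f'(0 := f' 0 + l)"
        using 2 g by (auto simp: f'_def fun_eq_iff split: nat.splits)
      ultimately show ?thesis using f good_step row_seqs_step by blast
    qed
  qed
qed

text \<open>In terms of beta numbers \<open>f i - i\<close>: if the bead of row \<open>Suc i\<close> can move and the bead of row
  \<open>i\<close> is less than \<open>l\<close> above it, then the latter bead can jump over it. So the gap
  is at least \<open>l\<close>, and row \<open>i\<close> becomes movable, possibly after moving row \<open>Suc i\<close> first.\<close>

lemma movable_row_imp_large_top: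
  assumes "f \<in> row_seqs" "good l f" "f (Suc (Suc i)) + l \<le> f (Suc i)" "l > 0"
  shows "f 1 + l \<le> Suc (f 0)"
  using assms
proof (induction i arbitrary: f)
  have large: "f (Suc i) + l \<le> Suc (f i)"
    if f: "f \<in> row_seqs" "good l f" "f (Suc (Suc i)) + l \<le> f (Suc i)" for f i
  proof (rule ccontr)
    assume "\<not> ?thesis"
    then have "bent l f" unfolding bent_def
      using f(3) row_seqs_Suc[OF f(1), of i] by (intro exI[of _ i] exI[of _ "Suc i"]) auto
    then show False using good_not_bent f by blast
  qed
  case 0
  then show ?case using large[of f 0] by simp
next
  case (Suc i)
  define g where "g = f(Suc (Suc i) := f (Suc (Suc i)) - l)"
  have s: "step l f g" using Suc.prems unfolding g_def step_def by blast
  have "f (Suc (Suc i)) + l \<le> Suc (f (Suc i))"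
  proof (rule ccontr)
    assume "\<not> ?thesis"
    then have "bent l f" unfolding bent_def
      using Suc.prems row_seqs_Suc[OF Suc.prems(1), of "Suc i"]
      by (intro exI[of _ "Suc i"] exI[of _ "Suc (Suc i)"]) auto
    then show False using good_not_bent Suc.prems by blast
  qed
  then have "g (Suc (Suc i)) + l \<le> g (Suc i)" using Suc.prems by (simp add: g_def)
  then have "g 1 + l \<le> Suc (g 0)"
    using Suc.IH[of g] Suc.prems row_seqs_step[OF _ s] good_step[OF _ s] by blast
  then show ?case by (simp add: g_def)
qed

text \<open>A movable row below the top would force the first two rows to differ by at least
  \<open>l - 1\<close>, and the top row itself is not movable either.\<close>

lemma good_small_top_core:
  assumes "f \<in> row_seqs" "good l f" "Suc (f 0) < f 1 + l"
  shows "core l f"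
proof -
  have "f i < f (Suc i) + l" for i
  proof (cases i)
    case 0 then show ?thesis using assms by simp
  next
    case (Suc j)
    have "f 1 \<le> f 0" using row_seqs_Suc[OF assms(1), of 0] by simp
    then have "l > 0" using assms(3) by simp
    then show ?thesis using movable_row_imp_large_top[OF assms(1,2), of j] assms(3) Suc
      by (metis not_le)
  qed
  then show ?thesis using assms good_not_bent by (auto simp: core_def)
qed

lemma core_tail: "core l f \<Longrightarrow> core l (\<lambda>i. f (Suc i))"
  using bent_tail by (auto simp: core_def)

text \<open>A difference of \<open>l - 1\<close> is too small for a horizontal hook in the new top
  row and, by \<open>bent_top\<close>, too large for a non-horizontal one starting there.\<close>

lemma core_case_nat:
  assumes "f \<in> row_seqs" "core l f" "l > 0"
  shows "core l (case_nat (f 0 + (l - 1)) f)"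
proof -
  let ?g = "case_nat (f 0 + (l - 1)) f"
  have "?g \<in> row_seqs" by (intro row_seqs_case_nat assms) simp
  moreover have "\<not> bent l (\<lambda>i. ?g (Suc i))" using assms by (simp add: core_def)
  ultimately have "\<not> bent l ?g" using bent_top[of ?g l] assms(3) by auto
  moreover have "?g i < ?g (Suc i) + l" for i
    using assms by (cases i) (auto simp: core_def)
  ultimately show ?thesis unfolding core_def by blast
qed

section \<open>Recursions by the first part for good sequences and cores\<close>

abbreviation goods :: "nat \<Rightarrow> nat \<Rightarrow> (nat \<Rightarrow> nat) set" where
  "goods l k \<equiv> {f \<in> row_seqs. good l f \<and> f 0 = k}"

abbreviation cores :: "nat \<Rightarrow> nat \<Rightarrow> (nat \<Rightarrow> nat) set" where
  "cores l k \<equiv> {f \<in> row_seqs. core l f \<and> f 0 = k}"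

abbreviation small_cores :: "nat \<Rightarrow> nat \<Rightarrow> (nat \<Rightarrow> nat) set" where
  "small_cores l k \<equiv> {f \<in> row_seqs. core l f \<and> f 0 = k \<and> Suc (f 0) < f 1 + l}"

lemma inj_on_tail:
  assumes "\<And>f. f \<in> S \<Longrightarrow> f 0 = k"
  shows "inj_on (\<lambda>f i. f (Suc i)) S"
proof (rule inj_onI)
  fix f g :: "nat \<Rightarrow> 'a"
  assume fg: "f \<in> S" "g \<in> S" "(\<lambda>i. f (Suc i)) = (\<lambda>i. g (Suc i))"
  show "f = g"
  proof
    fix i show "f i = g i" using fg assms by (cases i) (auto dest: fun_cong)
  qed
qed

text \<open>The inverse puts back a top row that is longer by \<open>l - 1\<close>. The property
  \<open>X\<close> is left general so that the bijection applies to both \<open>good\<close> and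
  \<open>core\<close>.\<close>

lemma bij_betw_tail:
  assumes "l > 0" "k \<ge> l - 1"
    and "\<And>f. f \<in> row_seqs \<Longrightarrow> X f \<Longrightarrow> X (\<lambda>i. f (Suc i))"
    and "\<And>f. f \<in> row_seqs \<Longrightarrow> X f \<Longrightarrow> X (case_nat (f 0 + (l - 1)) f)"
  shows "bij_betw (\<lambda>f i. f (Suc i)) {f \<in> row_seqs. X f \<and> f 0 = k \<and> Suc (f 0) = f 1 + l}
    {f \<in> row_seqs. X f \<and> f 0 = k - (l - 1)}"
proof (rule bij_betw_imageI)
  show "inj_on (\<lambda>f i. f (Suc i)) {f \<in> row_seqs. X f \<and> f 0 = k \<and> Suc (f 0) = f 1 + l}"
    by (rule inj_on_tail[of _ k]) simp
next
  show "(\<lambda>f i. f (Suc i)) ` {f \<in> row_seqs. X f \<and> f 0 = k \<and> Suc (f 0) = f 1 + l} =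
      {f \<in> row_seqs. X f \<and> f 0 = k - (l - 1)}" (is "_ ` ?A = ?B")
  proof (intro equalityI subsetI)
    fix g assume "g \<in> (\<lambda>f i. f (Suc i)) ` ?A"
    then show "g \<in> ?B" using assms(1,3) row_seqs_tail by auto
  next
    fix g assume g: "g \<in> ?B"
    have "X (case_nat (g 0 + (l - 1)) g)" using g assms(4) by blast
    moreover have "case_nat (g 0 + (l - 1)) g \<in> row_seqs"
      using g by (intro row_seqs_case_nat) auto
    ultimately have "case_nat (g 0 + (l - 1)) g \<in> ?A" using g assms(1,2) by simp
    then have "(\<lambda>i. case_nat (g 0 + (l - 1)) g (Suc i)) \<in> (\<lambda>f i. f (Suc i)) ` ?A"
      by (rule imageI[where f = "\<lambda>f i. f (Suc i)"])
    then show "g \<in> (\<lambda>f i. f (Suc i)) ` ?A" by simp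
  qed
qed

text \<open>Shortening is a \<open>step\<close> and so preserves goodness; its inverse, lengthening,
  does so by \<open>good_enlarge_top\<close>.\<close>

lemma bij_betw_shrink_top:
  assumes "k \<ge> l"
  shows "bij_betw (\<lambda>f. f(0 := f 0 - l)) {f \<in> row_seqs. good l f \<and> f 0 = k \<and> f 1 + l \<le> f 0}
    (goods l (k - l))"
proof (rule bij_betw_byWitness[where f' = "\<lambda>f. f(0 := f 0 + l)"])
  show "(\<lambda>f. f(0 := f 0 - l)) ` {f \<in> row_seqs. good l f \<and> f 0 = k \<and> f 1 + l \<le> f 0} \<subseteq> goods l (k - l)"
  proof clarsimp
    fix f assume f: "f \<in> row_seqs" "good l f" "f (Suc 0) + l \<le> f 0"
    then have "step l f (f(0 := f 0 - l))" by (auto simp: step_def)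
    then show "f(0 := f 0 - l) \<in> row_seqs \<and> good l (f(0 := f 0 - l))"
      using f row_seqs_step good_step by blast
  qed
  show "(\<lambda>f. f(0 := f 0 + l)) ` goods l (k - l) \<subseteq>
      {f \<in> row_seqs. good l f \<and> f 0 = k \<and> f 1 + l \<le> f 0}"
  proof (intro image_subsetI)
    fix f assume f: "f \<in> goods l (k - l)"
    have "f 1 \<le> f 0" using row_seqs_Suc[of f 0] f by simp
    then show "f(0 := f 0 + l) \<in> {f \<in> row_seqs. good l f \<and> f 0 = k \<and> f 1 + l \<le> f 0}"
      using f assms good_enlarge_top[of f l] row_seqs_upd0[of f "f 0 + l"] by auto
  qed
qed (auto simp: fun_eq_iff)

text \<open>The first two rows of a core differ by at most \<open>l - 1\<close>. The cores with
  difference exactly \<open>l - 1\<close> are counted by deleting the top row; the rest are the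
  \<open>small_cores\<close>.\<close>

lemma cores_recursion:
  assumes "l > 0" "finite (cores l k)"
  shows "card (cores l k) = (if k \<ge> l - 1 then card (cores l (k - (l - 1))) else 0) + card (small_cores l k)"
proof -
  let ?E = "{f \<in> row_seqs. core l f \<and> f 0 = k \<and> Suc (f 0) = f 1 + l}"
  have "Suc (f 0) \<le> f 1 + l" if "core l f" for f
    using that by (auto simp: core_def Suc_le_eq)
  then have eq: "cores l k = ?E \<union> small_cores l k"
    by (auto simp: le_less)
  have "card (cores l k) = card ?E + card (small_cores l k)"
    unfolding eq
  proof (rule card_Un_disjoint)
    show "finite ?E" "finite (small_cores l k)" by (rule finite_subset[OF _ assms(2)]; blast)+
  qed auto
  moreover have "card ?E = (if k \<ge> l - 1 then card (cores l (k - (l - 1))) else 0)"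
  proof (cases "k \<ge> l - 1")
    case True
    have "bij_betw (\<lambda>f i. f (Suc i)) ?E (cores l (k - (l - 1)))"
      using assms(1) True by (intro bij_betw_tail core_tail core_case_nat)
    from bij_betw_same_card[OF this] show ?thesis using True by (simp only: if_True)
  next
    case False
    then have "?E = {}" by auto
    then show ?thesis using False by (simp only: card.empty if_False)
  qed
  ultimately show ?thesis by simp
qed

text \<open>Good sequences with a small top difference are cores, so the last term is the same as in
  \<open>cores_recursion\<close> and can be eliminated later. Finiteness is carried through the same
  induction because the cardinalities of the disjoint classes are added. As \<open>l > 1\<close>,
  both \<open>k - l\<close> and \<open>k - (l - 1)\<close> are below \<open>k\<close> whenever they
  occur.\<close>

lemma goods_recursion:
  assumes "l > 1" "\<And>k. finite (cores l k)"
  shows "finite (goods l k) \<and> card (goods l k) =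
    (if k \<ge> l then card (goods l (k - l)) else 0) +
    (if k \<ge> l - 1 then card (goods l (k - (l - 1))) else 0) + card (small_cores l k)"
proof (induction k rule: less_induct)
  case (less k)
  let ?T = "{f \<in> row_seqs. good l f \<and> f 0 = k \<and> f 1 + l \<le> f 0}"
  let ?E = "{f \<in> row_seqs. good l f \<and> f 0 = k \<and> Suc (f 0) = f 1 + l}"
  have "goods l k = (?T \<union> ?E) \<union> {f \<in> row_seqs. good l f \<and> f 0 = k \<and> Suc (f 0) < f 1 + l}"
    by auto
  also have "{f \<in> row_seqs. good l f \<and> f 0 = k \<and> Suc (f 0) < f 1 + l} = small_cores l k"
    using good_small_top_core core_good by blast
  finally have eq: "goods l k = (?T \<union> ?E) \<union> small_cores l k" .
  have T: "finite ?T \<and> card ?T = (if k \<ge> l then card (goods l (k - l)) else 0)"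
  proof (cases "k \<ge> l")
    case True
    then have "k - l < k" using assms(1) by simp
    then have "finite (goods l (k - l))" using less.IH by blast
    then show ?thesis
      using bij_betw_finite[OF bij_betw_shrink_top[OF True]]
        bij_betw_same_card[OF bij_betw_shrink_top[OF True]] True by (simp only: if_True simp_thms)
  next
    case False
    then have "?T = {}" by auto
    then show ?thesis using False by (simp only: card.empty if_False finite.emptyI simp_thms)
  qed
  have E: "finite ?E \<and> card ?E = (if k \<ge> l - 1 then card (goods l (k - (l - 1))) else 0)"
  proof (cases "k \<ge> l - 1")
    case True
    have b: "bij_betw (\<lambda>f i. f (Suc i)) ?E (goods l (k - (l - 1)))"
    proof (rule bij_betw_tail)
      fix f assume f: "f \<in> row_seqs" "good l f"
      then show "good l (\<lambda>i. f (Suc i))" using good_tail by blast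
      show "good l (case_nat (f 0 + (l - 1)) f)"
        \<comment> \<open>The multiple of \<open>l\<close> is \<open>0\<close>: the new top row is
          longer by exactly \<open>l - 1\<close>.\<close>
        by (rule good_congruent_top[of _ _ 0]) (use f assms(1) row_seqs_case_nat in auto)
    qed (use assms True in auto)
    have "k - (l - 1) < k" using True assms(1) by simp
    then have "finite (goods l (k - (l - 1)))" using less.IH by blast
    then show ?thesis
      using bij_betw_finite[OF b] bij_betw_same_card[OF b] True by (simp only: if_True simp_thms)
  next
    case False
    then have "?E = {}" by auto
    then show ?thesis using False by (simp only: card.empty if_False finite.emptyI simp_thms)
  qed
  have S: "finite (small_cores l k)" by (rule finite_subset[OF _ assms(2)[of k]]) auto
  have "card (goods l k) = card (?T \<union> ?E) + card (small_cores l k)"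
    unfolding eq
  proof (rule card_Un_disjoint)
    show "finite (?T \<union> ?E)" using T E by blast
  qed (use S in auto)
  moreover have "card (?T \<union> ?E) = card ?T + card ?E"
  proof (rule card_Un_disjoint)
    show "finite ?T" "finite ?E" using T E by blast+
  qed auto
  moreover have "finite (goods l k)" unfolding eq using T E S by blast
  ultimately show ?case using T E by (simp only: simp_thms)
qed

section \<open>Counting cores\<close>

text \<open>\<open>beads f\<close> is the set of beta numbers read downwards from the largest one, so its
  complement has \<open>f 0\<close> elements, and being a core means being closed under adding \<open>l\<close>.\<close>

definition beads :: "(nat \<Rightarrow> nat) \<Rightarrow> nat set" where
  "beads f = range (\<lambda>i. f 0 + i - f i)"

lemma strict_mono_bead:
  assumes "f \<in> row_seqs" shows "strict_mono (\<lambda>i. f 0 + i - f i)"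
proof (rule strict_mono_Suc_iff[THEN iffD2], rule allI)
  fix i show "f 0 + i - f i < f 0 + Suc i - f (Suc i)"
    using row_seqs_Suc[OF assms, of i] row_seqs_mono[OF assms, of 0 i] by simp
qed

lemma strict_mono_range_eq:
  fixes f g :: "nat \<Rightarrow> nat"
  assumes "strict_mono f" "strict_mono g" "range f = range g"
  shows "f = g"
proof
  fix n show "f n = g n"
  proof (induction n rule: less_induct)
    case (less n)
    have le: "f n \<le> g n" if f: "strict_mono f" and g: "strict_mono g" and r: "range f = range g"
      and IH: "\<And>m. m < n \<Longrightarrow> f m = g m" for f g :: "nat \<Rightarrow> nat"
    proof -
      obtain m where m: "g n = f m" using r by (metis rangeE rangeI)
      have "\<not> m < n"
        using IH[of m] m strict_mono_eq[OF g] by (metis less_irrefl)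
      then show ?thesis using m strict_mono_less_eq[OF f] by simp
    qed
    show ?case using le[of f g] le[of g f] assms less by (metis antisym)
  qed
qed

text \<open>The elements of the range below \<open>n i\<close> are exactly the \<open>i\<close>
  values at the smaller indices. For the beads of \<open>f\<close>, the number of gaps below bead
  \<open>i\<close> is thus \<open>f 0 - f i\<close>.\<close>

lemma card_gaps_below:
  fixes n :: "nat \<Rightarrow> nat"
  assumes "strict_mono n"
  shows "card ({..<n i} - range n) = n i - i"
proof -
  have "{..<n i} - range n = {..<n i} - n ` {..<i}"
    using strict_mono_less[OF assms] by auto
  moreover have "card (n ` {..<i}) = i"
    using strict_mono_imp_inj_on[OF assms] by (simp add: card_image inj_on_subset)
  moreover have "n ` {..<i} \<subseteq> {..<n i}" using strict_mono_less[OF assms] by auto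
  ultimately show ?thesis by (simp add: card_Diff_subset)
qed

text \<open>The inverse enumerates \<open>N\<close> increasingly as \<open>n\<close> and reads off
  the row lengths \<open>k + i - n i\<close>, the number of gaps above the \<open>i\<close>-th
  element.\<close>

lemma bij_betw_beads:
  "bij_betw beads {f \<in> row_seqs. f 0 = k} {N. 0 \<in> N \<and> finite (- N) \<and> card (- N) = k}"
proof (rule bij_betw_imageI)
  show "inj_on beads {f \<in> row_seqs. f 0 = k}"
  proof (rule inj_onI)
    fix f g assume fg: "f \<in> {f \<in> row_seqs. f 0 = k}" "g \<in> {f \<in> row_seqs. f 0 = k}" "beads f = beads g"
    then have eq: "(\<lambda>i. f 0 + i - f i) = (\<lambda>i. g 0 + i - g i)"
      using strict_mono_bead[of f] strict_mono_bead[of g]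
      by (intro strict_mono_range_eq) (auto simp: beads_def)
    show "f = g"
    proof
      fix i show "f i = g i"
        using fun_cong[OF eq, of i] fg row_seqs_mono[of f 0 i] row_seqs_mono[of g 0 i] by auto
    qed
  qed
  show "beads ` {f \<in> row_seqs. f 0 = k} = {N. 0 \<in> N \<and> finite (- N) \<and> card (- N) = k}"
  proof (intro equalityI subsetI)
    fix N assume "N \<in> beads ` {f \<in> row_seqs. f 0 = k}"
    then obtain f where f: "f \<in> row_seqs" "f 0 = k" and N: "N = beads f" by auto
    obtain n where n: "f n = 0" using f by (auto simp: row_seqs_def)
    have zero: "f m = 0" if "n \<le> m" for m using row_seqs_mono[OF f(1) that] n by simp
    have "x \<in> N" if "k + n \<le> x" for x
      unfolding N beads_def using f zero[of "x - k"] that by (intro range_eqI[of _ _ "x - k"]) simp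
    \<comment> \<open>From the zero row \<open>n\<close> on, the beads are all the numbers from
      \<open>k + n\<close> upwards, so every gap lies below bead \<open>n\<close>.\<close>
    then have "- N = {..<f 0 + n - f n} - N" using f n by auto (meson not_le)
    moreover have "card \<dots> = k"
      unfolding N beads_def by (subst card_gaps_below[OF strict_mono_bead[OF f(1)]]) (use f n in simp)
    ultimately have "card (- N) = k" "finite (- N)"
      by (simp, metis finite_Diff finite_lessThan)
    moreover have "0 \<in> N" unfolding N beads_def by (rule range_eqI[of _ _ 0]) simp
    ultimately show "N \<in> {N. 0 \<in> N \<and> finite (- N) \<and> card (- N) = k}" by simp
  next
    fix N :: "nat set" assume "N \<in> {N. 0 \<in> N \<and> finite (- N) \<and> card (- N) = k}"
    then have N: "0 \<in> N" "finite (- N)" "card (- N) = k" by auto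
    have inf: "infinite N" using N(2) finite_Un[of N "- N"] by simp
    define n where "n = enumerate N"
    have sm: "strict_mono n" using inf by (simp add: n_def strict_mono_def)
    have rn: "range n = N" using inf by (simp add: n_def range_enumerate)
    have n0: "n 0 = 0" using N(1) by (simp add: n_def enumerate_0 Least_eq_0)
    have le: "n i \<le> k + i" for i
    proof -
      have "n i - i \<le> k"
        unfolding card_gaps_below[OF sm, symmetric] rn N(3)[symmetric]
        by (rule card_mono[OF N(2)]) auto
      then show ?thesis by simp
    qed
    \<comment> \<open>With \<open>b\<close> above all gaps and \<open>b \<le> n b\<close>, all
      \<open>k\<close> gaps lie below \<open>n b\<close>; this makes row \<open>b\<close>
      empty.\<close>
    obtain b where b: "\<And>x. x \<in> - N \<Longrightarrow> x < b" using N(2) by (meson finite_nat_iff_bounded lessThan_iff subsetD)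
    have "b \<le> n b" using strict_mono_imp_increasing[OF sm] by simp
    then have "{..<n b} - range n = - N" using rn b by fastforce
    then have nb: "n b - b = k" using card_gaps_below[OF sm, of b] N(3) by simp
    define f where "f i = k + i - n i" for i
    have "f \<in> row_seqs"
    proof (rule row_seqsI)
      show "f b = 0" using nb \<open>b \<le> n b\<close> by (simp add: f_def)
      fix i show "f (Suc i) \<le> f i"
        using strict_mono_less[OF sm, of i "Suc i"] by (simp add: f_def)
    qed
    moreover have "f 0 = k" by (simp add: f_def n0)
    moreover have "f 0 + i - f i = n i" for i using le[of i] \<open>f 0 = k\<close> by (simp add: f_def)
    then have "beads f = N" by (simp add: beads_def rn)
    ultimately show "N \<in> beads ` {f \<in> row_seqs. f 0 = k}" by blast
  qed
qed

text \<open>Both sides say that lowering the beta number of any row by \<open>l\<close> gives the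
  beta number of some row. Otherwise the lowered number falls strictly between two consecutive ones,
  which is an \<open>l\<close>-rim hook.\<close>

lemma core_iff_beads:
  assumes "f \<in> row_seqs" "l > 0"
  shows "core l f \<longleftrightarrow> (\<forall>x\<in>beads f. x + l \<in> beads f)"
proof -
  note mono = row_seqs_mono[OF assms(1)]
  have "core l f \<longleftrightarrow> (\<forall>i. \<exists>j. f i + j = l + i + f j)"
  proof (intro iffI allI)
    fix i assume c: "core l f"
    obtain n where n: "f n = 0" using assms by (auto simp: row_seqs_def)
    \<comment> \<open>The least \<open>j\<close> with \<open>P j\<close> is the first row after
      \<open>i\<close> whose beta number is below the lowered one of row \<open>i\<close>. For a
      core, the row before it must hit the lowered number exactly: otherwise row \<open>i\<close> is
      movable or a hook occupies the rows from \<open>i\<close> to that row.\<close>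
    define P where "P j \<longleftrightarrow> i < j \<and> l + i + f j < f i + j" for j
    have "f (n + l + i + 1) = 0" using mono[of n "n + l + i + 1"] n by simp
    then have ex: "P (n + l + i + 1)" by (simp add: P_def)
    define j where "j = Least P"
    have j: "P j" unfolding j_def using ex by (rule LeastI)
    then obtain j' where j': "j = Suc j'" by (cases j) (auto simp: P_def)
    have "\<not> P j'" using not_less_Least[of j' P] j' j_def by simp
    show "\<exists>j. f i + j = l + i + f j"
    proof (cases "j' = i")
      case True
      then have "f (Suc i) + l \<le> f i" using j j' by (simp add: P_def)
      then show ?thesis using c by (auto simp: core_def not_le[symmetric])
    next
      case False
      then have "i < j'" using j j' by (simp add: P_def)
      then have "f i + j' \<le> l + i + f j'" using \<open>\<not> P j'\<close> by (simp add: P_def)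
      moreover have "\<not> (f i + j' < l + i + f j')"
        using c j j' \<open>i < j'\<close> unfolding core_def bent_def P_def by fastforce
      ultimately show ?thesis by (intro exI[of _ j']) simp
    qed
  next
    assume ex: "\<forall>i. \<exists>j. f i + j = l + i + f j"
    \<comment> \<open>The lowered number would lie strictly between the beta numbers of rows
      \<open>j\<close> and \<open>Suc j\<close>, yet equal that of row \<open>m\<close>. The case
      \<open>j = i\<close> later excludes movable rows.\<close>
    have False if "f i + j < l + i + f j" "f (Suc j) + l + i \<le> f i + j" for i j
    proof -
      obtain m where m: "f i + m = l + i + f m" using ex by auto
      show False using that m mono[of m j] mono[of "Suc j" m] by (cases "m \<le> j") auto
    qed
    then have "\<not> bent l f" by (auto simp: bent_def)
    moreover have "f i < f (Suc i) + l" for i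
    proof (rule ccontr)
      assume "\<not> ?thesis"
      then show False using \<open>\<And>j i. f i + j < l + i + f j \<Longrightarrow> _ \<Longrightarrow> False\<close>[of i i] assms(2) by simp
    qed
    ultimately show "core l f" by (simp add: core_def)
  qed
  also have "\<dots> \<longleftrightarrow> (\<forall>i. \<exists>j. f 0 + i - f i + l = f 0 + j - f j)"
  proof -
    have "f i + j = l + i + f j \<longleftrightarrow> f 0 + i - f i + l = f 0 + j - f j" for i j
      using mono[of 0 i] mono[of 0 j] by auto
    then show ?thesis by simp
  qed
  also have "\<dots> \<longleftrightarrow> (\<forall>x\<in>beads f. x + l \<in> beads f)"
    by (auto simp: beads_def image_iff)
  finally show ?thesis .
qed

text \<open>\<open>L ! r\<close> is the number of gaps on the runner \<open>Suc r\<close> of the abacus; the runner \<open>0\<close> has none.\<close>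

definition runner_set :: "nat \<Rightarrow> nat list \<Rightarrow> nat set" where
  "runner_set l L = {x. x mod l = 0 \<or> L ! (x mod l - 1) \<le> x div l}"

lemma runner_set_Suc:
  assumes "r < l - 1"
  shows "Suc r + l * m \<in> runner_set l L \<longleftrightarrow> L ! r \<le> m"
proof -
  have r: "Suc r < l" using assms by simp
  then have "(Suc r + l * m) mod l = Suc r" "(Suc r + l * m) div l = m"
    by (simp_all only: mod_mult_self2 div_mult_self2 mod_less div_less)
  then show ?thesis unfolding runner_set_def by simp
qed

lemma Compl_runner_set:
  assumes "l > 0"
  shows "- runner_set l L = (\<lambda>(r, m). Suc r + l * m) ` Sigma {..<l - 1} (\<lambda>r. {..<L ! r})"
proof (intro equalityI subsetI)
  fix x assume x: "x \<in> - runner_set l L"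
  then have "x mod l \<noteq> 0" "x div l < L ! (x mod l - 1)" by (auto simp: runner_set_def)
  moreover have "x mod l < l" using assms by simp
  moreover have "x = Suc (x mod l - 1) + l * (x div l)" using \<open>x mod l \<noteq> 0\<close> by simp
  ultimately show "x \<in> (\<lambda>(r, m). Suc r + l * m) ` Sigma {..<l - 1} (\<lambda>r. {..<L ! r})"
    by (intro image_eqI[of _ _ "(x mod l - 1, x div l)"]) auto
next
  fix x assume "x \<in> (\<lambda>(r, m). Suc r + l * m) ` Sigma {..<l - 1} (\<lambda>r. {..<L ! r})"
  then obtain r m where x: "x = Suc r + l * m" and r: "r < l - 1" and m: "m < L ! r" by auto
  show "x \<in> - runner_set l L" unfolding x Compl_iff runner_set_Suc[OF r] using m by simp
qed

lemma card_Compl_runner_set: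
  assumes "l > 0" "length L = l - 1"
  shows "finite (- runner_set l L)" "card (- runner_set l L) = sum_list L"
proof -
  have "inj_on (\<lambda>(r, m). Suc r + l * m) (Sigma {..<l - 1} (\<lambda>r. {..<L ! r}))"
  proof (rule inj_onI, clarify)
    fix r m r' m' assume r: "r < l - 1" "r' < l - 1" and eq: "Suc r + l * m = Suc r' + l * m'"
    have "(Suc r + l * m) mod l = Suc r" "(Suc r' + l * m') mod l = Suc r'"
      using r by (simp_all only: mod_mult_self2 mod_less)
    then have "r = r'" using eq by (metis Suc_inject)
    then show "r = r' \<and> m = m'" using eq assms(1) by simp
  qed
  then have "card (- runner_set l L) = card (Sigma {..<l - 1} (\<lambda>r. {..<L ! r}))"
    by (simp add: Compl_runner_set[OF assms(1)] card_image)
  also have "\<dots> = sum_list L"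
    by (simp add: sum_list_sum_nth assms(2) lessThan_atLeast0)
  finally show "card (- runner_set l L) = sum_list L" .
  show "finite (- runner_set l L)" unfolding Compl_runner_set[OF assms(1)] by blast
qed

text \<open>A set closed under adding \<open>l\<close> is, on each runner, a final segment of the
  levels, hence given by its number of gaps there. Runner \<open>0\<close> is full because it
  contains \<open>0\<close>.\<close>

lemma bij_betw_runner_set:
  assumes "l > 0"
  shows "bij_betw (runner_set l) {L. length L = l - 1 \<and> sum_list L = k}
    {N. 0 \<in> N \<and> finite (- N) \<and> card (- N) = k \<and> (\<forall>x\<in>N. x + l \<in> N)}"
proof (rule bij_betw_imageI)
  show "inj_on (runner_set l) {L. length L = l - 1 \<and> sum_list L = k}"
  proof (rule inj_onI)
    fix L M assume LM: "L \<in> {L. length L = l - 1 \<and> sum_list L = k}"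
      "M \<in> {L. length L = l - 1 \<and> sum_list L = k}" "runner_set l L = runner_set l M"
    have "L ! r = M ! r" if "r < l - 1" for r
    proof -
      have "L ! r \<le> m \<longleftrightarrow> M ! r \<le> m" for m
        using LM(3) runner_set_Suc[OF that] by metis
      then show ?thesis by (metis order_refl antisym)
    qed
    then show "L = M" using LM by (intro nth_equalityI) auto
  qed
  show "runner_set l ` {L. length L = l - 1 \<and> sum_list L = k} =
    {N. 0 \<in> N \<and> finite (- N) \<and> card (- N) = k \<and> (\<forall>x\<in>N. x + l \<in> N)}"
  proof (intro equalityI subsetI)
    fix N assume "N \<in> runner_set l ` {L. length L = l - 1 \<and> sum_list L = k}"
    then obtain L where L: "length L = l - 1" "sum_list L = k" "N = runner_set l L" by auto
    then show "N \<in> {N. 0 \<in> N \<and> finite (- N) \<and> card (- N) = k \<and> (\<forall>x\<in>N. x + l \<in> N)}"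
      using card_Compl_runner_set[OF assms L(1)] assms by (auto simp: runner_set_def)
  next
    fix N assume "N \<in> {N. 0 \<in> N \<and> finite (- N) \<and> card (- N) = k \<and> (\<forall>x\<in>N. x + l \<in> N)}"
    then have N: "0 \<in> N" "finite (- N)" "card (- N) = k" "\<And>x. x \<in> N \<Longrightarrow> x + l \<in> N" by auto
    have up: "x + l * d \<in> N" if "x \<in> N" for x d
      by (induction d) (use that N(4) in \<open>auto simp: algebra_simps\<close>, metis N(4) add.assoc add.commute)
    \<comment> \<open>The first occupied level of runner \<open>Suc r\<close>, which is also the
      number of gaps on it.\<close>
    define c where "c r = (LEAST m. Suc r + l * m \<in> N)" for r
    have c: "Suc r + l * m \<in> N \<longleftrightarrow> c r \<le> m" for r m
    proof
      assume "Suc r + l * m \<in> N" then show "c r \<le> m" unfolding c_def by (rule Least_le)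
    next
      \<comment> \<open>Level \<open>b\<close> lies beyond all gaps, so an occupied level exists and
        the least one is attained.\<close>
      obtain b where b: "\<And>x. x \<in> - N \<Longrightarrow> x < b" using N(2) by (meson finite_nat_iff_bounded lessThan_iff subsetD)
      have "b \<le> l * b" using assms by simp
      then have "\<not> Suc r + l * b < b" by linarith
      then have "Suc r + l * b \<in> N" using b by blast
      then have "Suc r + l * c r \<in> N" unfolding c_def by (rule LeastI)
      moreover assume "c r \<le> m"
      then have "Suc r + l * m = Suc r + l * c r + l * (m - c r)" by (simp flip: add_mult_distrib2)
      ultimately show "Suc r + l * m \<in> N" using up by metis
    qed
    define L where "L = map c [0..<l - 1]"
    have len: "length L = l - 1" by (simp add: L_def)
    have "N = runner_set l L"
    proof (rule set_eqI)
      fix x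
      show "x \<in> N \<longleftrightarrow> x \<in> runner_set l L"
      proof (cases "x mod l = 0")
        case True
        then have "x = 0 + l * (x div l)" by auto
        then have "x \<in> N" using up[OF N(1)] by metis
        then show ?thesis using True by (simp add: runner_set_def)
      next
        case False
        have r: "x mod l - 1 < l - 1" using False assms mod_less_divisor[of l x] by linarith
        have x: "x = Suc (x mod l - 1) + l * (x div l)" using False by simp
        have "x \<in> N \<longleftrightarrow> c (x mod l - 1) \<le> x div l" using c x by metis
        also have "\<dots> \<longleftrightarrow> x \<in> runner_set l L"
          using False r by (simp add: runner_set_def L_def)
        finally show ?thesis .
      qed
    qed
    moreover from this have "sum_list L = k" using card_Compl_runner_set(2)[OF assms len] N(3) by simp
    ultimately show "N \<in> runner_set l ` {L. length L = l - 1 \<and> sum_list L = k}" using len by blast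
  qed
qed

lemma bij_betw_cores:
  assumes "l > 0"
  shows "bij_betw beads (cores l k) {N. 0 \<in> N \<and> finite (- N) \<and> card (- N) = k \<and> (\<forall>x\<in>N. x + l \<in> N)}"
proof -
  have "beads ` cores l k = {N. 0 \<in> N \<and> finite (- N) \<and> card (- N) = k \<and> (\<forall>x\<in>N. x + l \<in> N)}"
  proof -
    have "cores l k = {f \<in> {f \<in> row_seqs. f 0 = k}. \<forall>x\<in>beads f. x + l \<in> beads f}"
      using core_iff_beads assms by auto
    also have "beads ` \<dots> = {N \<in> beads ` {f \<in> row_seqs. f 0 = k}. \<forall>x\<in>N. x + l \<in> N}"
      by blast
    also have "\<dots> = {N. 0 \<in> N \<and> finite (- N) \<and> card (- N) = k \<and> (\<forall>x\<in>N. x + l \<in> N)}"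
      using bij_betw_imp_surj_on[OF bij_betw_beads[of k]] by auto
    finally show ?thesis .
  qed
  moreover have "inj_on beads (cores l k)"
    by (rule inj_on_subset[OF bij_betw_imp_inj_on[OF bij_betw_beads[of k]]]) auto
  ultimately show ?thesis by (simp add: bij_betw_def)
qed

text \<open>The two bijections identify cores with lists of \<open>l - 1\<close> natural numbers
  with sum \<open>k\<close>, which are counted by stars and bars.\<close>

lemma
  assumes "l > 1"
  shows finite_cores: "finite (cores l k)"
    and card_cores: "card (cores l k) = (l - 1 + k - 1) choose k"
proof -
  let ?L = "{L :: nat list. length L = l - 1 \<and> sum_list L = k}"
  have l: "l > 0" using assms by simp
  have "?L \<subseteq> {L. set L \<subseteq> {..k} \<and> length L = l - 1}"
    using member_le_sum_list by fastforce
  then have "finite ?L" by (rule finite_subset) (simp add: finite_lists_length_eq)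
  then show "finite (cores l k)"
    using bij_betw_finite[OF bij_betw_cores[OF l, of k]] bij_betw_finite[OF bij_betw_runner_set[OF l, of k]]
    by metis
  have "card (cores l k) = card ?L"
    using bij_betw_same_card[OF bij_betw_cores[OF l, of k]]
      bij_betw_same_card[OF bij_betw_runner_set[OF l, of k]] by metis
  also have "\<dots> = (l - 1 + k - 1) choose k"
    using card_length_sum_list[of "l - 1" k] by (simp add: add.commute)
  finally show "card (cores l k) = (l - 1 + k - 1) choose k" .
qed

section \<open>Rim hooks of Young diagrams\<close>

definition part :: "nat list \<Rightarrow> nat \<Rightarrow> nat" where
  "part p i = (if i < length p then p ! i else 0)"

lemma part_pos_iff: "is_partition p \<Longrightarrow> 0 < part p i \<longleftrightarrow> i < length p"
  by (auto simp: part_def is_partition_def) (metis gr0I nth_mem)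

lemma first_part_eq: "first_part p = part p 0"
  by (cases p) (auto simp: first_part_def part_def)

lemma young_diagram_eq: "young_diagram p = {(i, j). j < part p i}"
  by (auto simp: young_diagram_def part_def split: if_splits)

lemma bij_betw_part: "bij_betw part {p. is_partition p} row_seqs"
proof (rule bij_betw_imageI)
  show "inj_on part {p. is_partition p}"
  proof (rule inj_onI)
    fix p q assume pq: "p \<in> {p. is_partition p}" "q \<in> {p. is_partition p}" "part p = part q"
    have "i < length p \<longleftrightarrow> i < length q" for i
      using pq part_pos_iff[of p i] part_pos_iff[of q i] by simp
    then have "length p = length q" by (metis less_irrefl linorder_neqE_nat)
    then show "p = q"
      using fun_cong[OF pq(3)] by (intro nth_equalityI) (simp_all add: part_def, metis)
  qed
  show "part ` {p. is_partition p} = row_seqs"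
  proof (intro equalityI subsetI)
    fix f assume "f \<in> part ` {p. is_partition p}"
    then obtain p where p: "is_partition p" "f = part p" by auto
    show "f \<in> row_seqs"
    proof (rule row_seqsI)
      show "f (length p) = 0" by (simp add: p part_def)
      fix i show "f (Suc i) \<le> f i"
        using p(1) sorted_wrt_nth_less[of "(\<ge>)" p i "Suc i"]
        by (auto simp: p(2) part_def is_partition_def)
    qed
  next
    fix f assume f: "f \<in> row_seqs"
    then have "\<exists>n. f n = 0" by (auto simp: row_seqs_def)
    define n where "n = (LEAST n. f n = 0)"
    have n: "f n = 0" unfolding n_def using \<open>\<exists>n. f n = 0\<close> by (rule LeastI_ex)
    have pos: "f i \<noteq> 0" if "i < n" for i
      using not_less_Least[of i "\<lambda>n. f n = 0"] that n_def by auto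
    have "0 \<notin> f ` {0..<n}" using pos by (metis atLeastLessThan_iff imageE)
    then have "is_partition (map f [0..<n])"
      using row_seqs_mono[OF f] by (simp add: is_partition_def sorted_wrt_iff_nth_less)
    moreover have "f i = 0" if "n \<le> i" for i using row_seqs_mono[OF f that] n by simp
    then have "part (map f [0..<n]) = f" by (auto simp: part_def fun_eq_iff)
    ultimately show "f \<in> part ` {p. is_partition p}" by (metis image_eqI mem_Collect_eq)
  qed
qed

lemma part_in_row_seqs: "is_partition p \<Longrightarrow> part p \<in> row_seqs"
  using bij_betw_part by (auto simp: bij_betw_def)

lemma row_seq_obtains_partition:
  assumes "f \<in> row_seqs"
  obtains p where "is_partition p" "part p = f"
proof -
  have "f \<in> part ` {p. is_partition p}" using assms bij_betw_part by (simp add: bij_betw_def)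
  then show thesis using that by blast
qed

definition skew :: "(nat \<Rightarrow> nat) \<Rightarrow> (nat \<Rightarrow> nat) \<Rightarrow> box set" where
  "skew f g = {(i, j). g i \<le> j \<and> j < f i}"

text \<open>The two partitions determine the removed boxes, so rim hooks can be studied through row
  lengths alone.\<close>

lemma rim_hook_removal_iff:
  "rim_hook_removal l p R q \<longleftrightarrow> is_partition q \<and> (\<forall>i. part q i \<le> part p i) \<and>
    R = skew (part p) (part q) \<and> card R = l \<and> connected_boxes R \<and> \<not> contains_2x2 R"
proof -
  have "R \<subseteq> young_diagram p \<and> young_diagram q = young_diagram p - R \<longleftrightarrow>
      (\<forall>i. part q i \<le> part p i) \<and> R = skew (part p) (part q)" (is "?L \<longleftrightarrow> ?R")
  proof
    assume L: ?L
    have "part q i \<le> part p i" for i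
    proof (rule ccontr)
      assume "\<not> ?thesis"
      then have "(i, part p i) \<in> young_diagram q" by (simp add: young_diagram_eq)
      then have "(i, part p i) \<in> young_diagram p" using L by blast
      then show False by (simp add: young_diagram_eq)
    qed
    moreover have "R = young_diagram p - young_diagram q" using L by blast
    ultimately show ?R by (auto simp: young_diagram_eq skew_def)
  next
    assume ?R
    then show ?L by (auto simp: young_diagram_eq skew_def intro: less_le_trans)
  qed
  then show ?thesis by (auto simp: rim_hook_removal_def)
qed

abbreviation path_rel :: "box set \<Rightarrow> box \<Rightarrow> box \<Rightarrow> bool" where
  "path_rel R x y \<equiv> x \<in> R \<and> y \<in> R \<and> adjacent x y"

lemma row_path:
  assumes "(k, c) \<in> skew f g" "(k, d) \<in> skew f g" "d \<le> c"
  shows "(path_rel (skew f g))\<^sup>*\<^sup>* (k, c) (k, d)"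
  using assms(3,1)
proof (induction c rule: dec_induct)
  case base
  then show ?case by simp
next
  case (step c)
  then have "(k, c) \<in> skew f g" using assms(2) by (auto simp: skew_def)
  moreover have "adjacent (k, Suc c) (k, c)" by (simp add: adjacent_def)
  ultimately have "path_rel (skew f g) (k, Suc c) (k, c)" using step.prems by simp
  then show ?case using step.IH[OF \<open>(k, c) \<in> skew f g\<close>] by (rule converse_rtranclp_into_rtranclp)
qed

text \<open>Adjacency is symmetric, so two paths into the common box \<open>t\<close> can be
  joined.\<close>

lemma connected_boxes_if_paths_to:
  assumes "\<And>a. a \<in> R \<Longrightarrow> (path_rel R)\<^sup>*\<^sup>* a t"
  shows "connected_boxes R"
  unfolding connected_boxes_def
proof (intro ballI)
  fix a b assume "a \<in> R" "b \<in> R"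
  have "symp (path_rel R)" by (auto simp: symp_def adjacent_def)
  then have "(path_rel R)\<^sup>*\<^sup>* t b"
    using assms[OF \<open>b \<in> R\<close>] by (rule sympD[OF symp_rtranclp])
  with assms[OF \<open>a \<in> R\<close>] show "(path_rel R)\<^sup>*\<^sup>* a b" by (rule rtranclp_trans)
qed

section \<open>Horizontal removals as steps\<close>

lemma remove_horizontal_imp_step:
  assumes "is_partition p" "l > 0" "remove_horizontal l p q"
  shows "step l (part p) (part q)"
proof -
  let ?f = "part p" and ?g = "part q"
  obtain i where i: "\<forall>b\<in>skew ?f ?g. fst b = i" and q: "is_partition q"
    and le: "\<And>k. ?g k \<le> ?f k" and card: "card (skew ?f ?g) = l"
    using assms(3) by (auto simp: remove_horizontal_def horizontal_def rim_hook_removal_iff)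
  have eq: "?g k = ?f k" if "k \<noteq> i" for k
  proof (rule ccontr)
    assume "?g k \<noteq> ?f k"
    then have "(k, ?g k) \<in> skew ?f ?g" using le[of k] by (simp add: skew_def)
    then show False using i that by auto
  qed
  have "skew ?f ?g = Pair i ` {?g i..<?f i}" using i by (auto simp: skew_def)
  then have "l = ?f i - ?g i" using card by (simp add: card_image inj_on_def)
  moreover have "?g (Suc i) \<le> ?g i" using row_seqs_Suc[OF part_in_row_seqs[OF q]] .
  moreover have "?f (Suc i) = ?g (Suc i)" using eq by simp
  ultimately have "?f (Suc i) + l \<le> ?f i" "?g i = ?f i - l" using le[of i] assms(2) by linarith+
  moreover from this have "?g = ?f(i := ?f i - l)" using eq by (simp add: fun_eq_iff)
  ultimately show ?thesis unfolding step_def by blast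
qed

lemma step_imp_remove_horizontal:
  assumes "is_partition q" "l > 0" "step l (part p) (part q)"
  shows "remove_horizontal l p q"
proof -
  let ?f = "part p" and ?g = "part q"
  obtain i where i: "?f (Suc i) + l \<le> ?f i" and g: "?g = ?f(i := ?f i - l)"
    using assms(3) by (auto simp: step_def)
  have skew: "skew ?f ?g = Pair i ` {?g i..<?f i}"
    unfolding g by (auto simp: skew_def split: if_splits)
  then have card: "card (skew ?f ?g) = l" using i g by (simp add: card_image inj_on_def)
  have "connected_boxes (skew ?f ?g)"
  proof (rule connected_boxes_if_paths_to)
    fix a assume a: "a \<in> skew ?f ?g"
    then obtain c where c: "a = (i, c)" "?g i \<le> c" using skew by auto
    show "(path_rel (skew ?f ?g))\<^sup>*\<^sup>* a (i, ?g i)"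
      unfolding c(1) by (rule row_path) (use a c i g assms(2) in \<open>auto simp: skew_def\<close>)
  qed
  moreover have h: "horizontal (skew ?f ?g)" unfolding skew horizontal_def by auto
  moreover have "\<not> contains_2x2 (skew ?f ?g)" unfolding skew contains_2x2_def by auto
  moreover have "\<forall>k. ?g k \<le> ?f k" using g by simp
  ultimately have "rim_hook_removal l p (skew ?f ?g) q"
    using card assms(1) by (simp add: rim_hook_removal_iff)
  then show ?thesis using h unfolding remove_horizontal_def by blast
qed

section \<open>Non-horizontal hooks as bent sequences\<close>

lemma path_crosses_row:
  assumes "(path_rel R)\<^sup>*\<^sup>* a b" "fst a \<le> k" "k < fst b"
  obtains c where "(k, c) \<in> R" "(Suc k, c) \<in> R"
proof -
  have "\<exists>c. (k, c) \<in> R \<and> (Suc k, c) \<in> R"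
    using assms
  proof (induction rule: rtranclp_induct)
    case base
    then show ?case by simp
  next
    case (step x y)
    show ?case
    proof (cases "k < fst x")
      case True
      then show ?thesis using step.IH step.prems(1) by blast
    next
      case False
      \<comment> \<open>Adjacent boxes differ by at most one in the row, so the path passes row
        \<open>k\<close> by a vertical step.\<close>
      then have "fst x = k \<and> fst y = Suc k \<and> snd x = snd y"
        using step.hyps(2) step.prems(2) by (auto simp: adjacent_def)
      then have "(k, snd x) = x" "(Suc k, snd x) = y" by (simp_all add: prod_eq_iff)
      then show ?thesis using step.hyps(2) by metis
    qed
  qed
  then show ?thesis using that by blast
qed

text \<open>The sum telescopes: each row \<open>k < j\<close> loses
  \<open>f k - f (Suc k) + 1\<close> boxes. The additive form avoids truncated subtraction.\<close>

lemma ribbon_sum: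
  fixes f g :: "nat \<Rightarrow> nat"
  assumes "i \<le> j" "\<And>k. g k \<le> f k" "\<And>k. i \<le> k \<Longrightarrow> k < j \<Longrightarrow> f (Suc k) = Suc (g k)"
  shows "(\<Sum>k=i..j. f k - g k) + g j + i = f i + j"
  using assms(1,3)
proof (induction j rule: dec_induct)
  case base
  then show ?case using assms(2)[of i] by simp
next
  case (step j)
  then show ?case using assms(2)[of "Suc j"] step.prems[of j] by simp
qed

lemma card_skew_ribbon:
  assumes "i \<le> j" "\<And>k. g k \<le> f k" "\<And>k. i \<le> k \<Longrightarrow> k < j \<Longrightarrow> f (Suc k) = Suc (g k)"
    and "\<And>k. k < i \<or> j < k \<Longrightarrow> g k = f k"
  shows "card (skew f g) + g j + i = f i + j"
proof -
  have "skew f g = Sigma {i..j} (\<lambda>k. {g k..<f k})"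
    using assms(4) by (fastforce simp: skew_def not_le[symmetric])
  then show ?thesis using ribbon_sum[of i j g f] assms(1-3) by simp
qed

text \<open>Connectedness makes consecutive rows of the hook overlap, and the absence of a 2x2
  square limits the overlap to one column. The size \<open>l\<close> then fixes the remaining length
  of the last row \<open>j\<close>, and \<open>?f (Suc j) \<le> ?g j < ?f j\<close> becomes the
  condition in \<open>bent\<close>.\<close>

lemma nonhorizontal_rim_hook_imp_bent:
  assumes "is_partition p" "has_nonhorizontal_rim_hook l p"
  shows "bent l (part p)"
proof -
  let ?f = "part p"
  obtain q where q: "is_partition q" and le: "\<And>k. part q k \<le> ?f k"
    and card: "card (skew ?f (part q)) = l" and conn: "connected_boxes (skew ?f (part q))"
    and no22: "\<not> contains_2x2 (skew ?f (part q))" and nh: "\<not> horizontal (skew ?f (part q))"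
    using assms(2) by (auto simp: has_nonhorizontal_rim_hook_def rim_hook_def rim_hook_removal_iff)
  let ?g = "part q" and ?R = "skew (part p) (part q)"
  have f: "?f \<in> row_seqs" and g: "?g \<in> row_seqs" using assms(1) q part_in_row_seqs by auto
  define I where "I = {k. ?g k < ?f k}"
  have "I \<subseteq> {..<length p}" by (auto simp: I_def part_def split: if_splits)
  then have fin: "finite I" using finite_subset by blast
  have rows: "fst b \<in> I" if "b \<in> ?R" for b using that by (auto simp: skew_def I_def)
  have "I \<noteq> {}" using nh rows unfolding horizontal_def by (metis empty_iff)
  define i j where "i = Min I" and "j = Max I"
  have ij: "i \<in> I" "j \<in> I" and bounds: "\<And>k. k \<in> I \<Longrightarrow> i \<le> k \<and> k \<le> j"
    using fin \<open>I \<noteq> {}\<close> by (auto simp: i_def j_def)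
  have "i \<noteq> j"
  proof
    assume "i = j"
    then have "\<forall>b\<in>?R. fst b = i" using rows bounds by (metis antisym)
    then show False using nh by (auto simp: horizontal_def)
  qed
  then have "i < j" using bounds[OF ij(2)] by simp
  have ribbon: "?f (Suc k) = Suc (?g k)" if k: "i \<le> k" "k < j" for k
  proof (rule antisym)
    have "(i, ?g i) \<in> ?R" "(j, ?g j) \<in> ?R" using ij by (auto simp: I_def skew_def)
    then have "(path_rel ?R)\<^sup>*\<^sup>* (i, ?g i) (j, ?g j)" using conn by (simp add: connected_boxes_def)
    then obtain c where "(k, c) \<in> ?R" "(Suc k, c) \<in> ?R" using k by (elim path_crosses_row[where k = k]) simp_all
    then show "Suc (?g k) \<le> ?f (Suc k)" by (auto simp: skew_def)
    show "?f (Suc k) \<le> Suc (?g k)"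
    proof (rule ccontr)
      assume "\<not> ?thesis"
      then have "{(k, ?g k), (k, Suc (?g k)), (Suc k, ?g k), (Suc k, Suc (?g k))} \<subseteq> ?R"
        using row_seqs_Suc[OF f, of k] row_seqs_Suc[OF g, of k] by (auto simp: skew_def)
      then show False using no22 unfolding contains_2x2_def by blast
    qed
  qed
  have out: "?g k = ?f k" if "k < i \<or> j < k" for k
    using that bounds[of k] le[of k] by (metis I_def le_neq_implies_less mem_Collect_eq not_le)
  have "l + ?g j + i = ?f i + j"
    using card_skew_ribbon[of i j ?g ?f] le ribbon out \<open>i < j\<close> card by simp
  moreover have "?f (Suc j) \<le> ?g j" using out[of "Suc j"] row_seqs_Suc[OF g, of j] by simp
  moreover have "?g j < ?f j" using ij by (simp add: I_def)
  ultimately show ?thesis using \<open>i < j\<close> unfolding bent_def by (intro exI[of _ i] exI[of _ j]) simp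
qed

lemma bent_imp_nonhorizontal_rim_hook:
  assumes "is_partition p" "bent l (part p)"
  shows "has_nonhorizontal_rim_hook l p"
proof -
  let ?f = "part p"
  have f: "?f \<in> row_seqs" using assms(1) part_in_row_seqs by auto
  obtain i j where ij: "i < j" "?f i + j < l + i + ?f j" "?f (Suc j) + l + i \<le> ?f i + j"
    using assms(2) by (auto simp: bent_def)
  \<comment> \<open>The length of row \<open>j\<close> after the removal, forced by the size
    \<open>l\<close> of the hook.\<close>
  define v where "v = ?f i + j - (l + i)"
  have v: "v + l + i = ?f i + j" "v < ?f j" "?f (Suc j) \<le> v" using ij by (auto simp: v_def)
  \<comment> \<open>Peeling off the rim leaves each row from \<open>i\<close> to
    \<open>j - 1\<close> one box shorter than the next row was. The rows up to \<open>j\<close> are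
    nonempty, so the subtraction of \<open>1\<close> is exact.\<close>
  define g where "g k = (if i \<le> k \<and> k < j then ?f (Suc k) - 1 else if k = j then v else ?f k)" for k
  have pos: "0 < ?f k" if "k \<le> j" for k using row_seqs_mono[OF f that] v by simp
  have le: "g k \<le> ?f k" for k using row_seqs_Suc[OF f, of k] v by (auto simp: g_def)
  have lt: "g k < ?f k" if "i \<le> k" "k \<le> j" for k
    using row_seqs_Suc[OF f, of k] pos[of k] pos[of "Suc k"] v that by (auto simp: g_def)
  have out: "g k = ?f k" if "k < i \<or> j < k" for k using that ij by (auto simp: g_def)
  have ribbon: "?f (Suc k) = Suc (g k)" if "i \<le> k" "k < j" for k
    using that pos[of "Suc k"] by (simp add: g_def)
  have gj: "g j = v" by (simp add: g_def)
  have "g \<in> row_seqs"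
  proof (rule row_seqsI)
    have "?f (length p + Suc j) = 0" by (simp add: part_def)
    then show "g (length p + Suc j) = 0" using le[of "length p + Suc j"] by simp
    fix k
    consider "k < i" | "j < k" | "i \<le> k" "k < j" | "k = j" by linarith
    then show "g (Suc k) \<le> g k"
    proof cases
      case 3
      then show ?thesis using lt[of "Suc k"] ribbon[of k] by simp
    next
      case 4
      then show ?thesis using out[of "Suc j"] gj v by simp
    qed (use out[of k] le[of "Suc k"] row_seqs_Suc[OF f, of k] in auto)
  qed
  then obtain q where q: "is_partition q" "part q = g" using row_seq_obtains_partition by blast
  let ?R = "skew ?f g"
  have rows: "i \<le> k \<and> k \<le> j" if "(k, c) \<in> ?R" for k c
    using that out[of k] by (auto simp: skew_def not_less[symmetric])
  have left: "(k, g k) \<in> ?R" if "i \<le> k" "k \<le> j" for k using lt that by (simp add: skew_def)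
  have "card ?R = l" using card_skew_ribbon[of i j g ?f] le ribbon out ij(1) gj v by simp
  moreover have "connected_boxes ?R"
  proof (rule connected_boxes_if_paths_to)
    \<comment> \<open>From the left end of a row of the hook one steps down into the next row and
      walks to its left end, until the last row is reached.\<close>
    have left_path: "(path_rel ?R)\<^sup>*\<^sup>* (k, g k) (j, v)" if "k \<le> j" "i \<le> k" for k
      using that
    proof (induction k rule: inc_induct)
      case base
      then show ?case using gj by simp
    next
      case (step k)
      have down: "(Suc k, g k) \<in> ?R"
        using lt[of "Suc k"] ribbon[of k] step by (auto simp: skew_def)
      have "path_rel ?R (k, g k) (Suc k, g k)"
        using left[of k] down step by (auto simp: adjacent_def)
      also have "(path_rel ?R)\<^sup>*\<^sup>* (Suc k, g k) (Suc k, g (Suc k))"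
        by (rule row_path) (use down left[of "Suc k"] step in \<open>auto simp: skew_def\<close>)
      also have "(path_rel ?R)\<^sup>*\<^sup>* (Suc k, g (Suc k)) (j, v)" using step by simp
      finally show ?case .
    qed
    fix a assume a: "a \<in> ?R"
    obtain k c where kc: "a = (k, c)" by (cases a)
    have k: "i \<le> k" "k \<le> j" using rows a kc by auto
    have "(path_rel ?R)\<^sup>*\<^sup>* (k, c) (k, g k)"
      by (rule row_path) (use a kc left[OF k] in \<open>auto simp: skew_def\<close>)
    then show "(path_rel ?R)\<^sup>*\<^sup>* a (j, v)"
      unfolding kc using left_path[OF k(2,1)] by (rule rtranclp_trans)
  qed
  moreover have "\<not> contains_2x2 ?R"
  proof
    assume "contains_2x2 ?R"
    then obtain k c where kc: "(k, c) \<in> ?R" "(Suc k, Suc c) \<in> ?R" by (auto simp: contains_2x2_def)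
    then have "i \<le> k" "k < j" using rows[of k c] rows[of "Suc k" "Suc c"] by auto
    then show False using kc ribbon[of k] by (auto simp: skew_def)
  qed
  moreover have "\<not> horizontal ?R"
  proof
    assume "horizontal ?R"
    moreover have "(i, g i) \<in> ?R" "(j, g j) \<in> ?R" using left ij(1) by auto
    ultimately show False using ij(1) unfolding horizontal_def by (metis fst_conv less_irrefl)
  qed
  moreover have "rim_hook_removal l p ?R q" if "card ?R = l" "connected_boxes ?R" "\<not> contains_2x2 ?R"
    using that q le by (simp add: rim_hook_removal_iff)
  ultimately show ?thesis
    unfolding has_nonhorizontal_rim_hook_def rim_hook_def by blast
qed

text \<open>The last \<open>l\<close> of the rows of a fixed nonzero length end in a vertical \<open>l\<close>-rim hook, so
  regularity is implied by the condition on rim hooks.\<close>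

lemma regular_if_not_bent:
  assumes "is_partition p" "l \<ge> 2" "\<not> bent l (part p)"
  shows "regular_partition l p"
  unfolding regular_partition_def
proof (intro conjI ballI assms(1))
  fix a assume a: "a \<in> set p"
  have f: "part p \<in> row_seqs" using part_in_row_seqs assms(1) .
  define S where "S = {i. i < length p \<and> p ! i = a}"
  show "count_list p a < l"
  proof (rule ccontr)
    assume "\<not> ?thesis"
    moreover have "count_list p a = card S"
      by (simp add: S_def count_list_eq_length_filter length_filter_conv_card eq_commute)
    ultimately have card: "l \<le> card S" by simp
    have fin: "finite S" by (simp add: S_def)
    have "S \<noteq> {}" using card assms(2) by auto
    define j where "j = Max S"
    have j: "j \<in> S" "\<And>k. k \<in> S \<Longrightarrow> k \<le> j" using fin \<open>S \<noteq> {}\<close> by (auto simp: j_def)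
    have m: "Min S \<in> S" "\<And>k. k \<in> S \<Longrightarrow> Min S \<le> k" using fin \<open>S \<noteq> {}\<close> by auto
    have "S \<subseteq> {Min S..j}" using m j by auto
    then have "card S \<le> Suc j - Min S" using card_mono[of "{Min S..j}" S] by simp
    then have le: "l + Min S \<le> Suc j" using card assms(2) by linarith
    define i where "i = Suc j - l"
    have i: "Min S \<le> i" "i < j" "i + l = Suc j" using le assms(2) by (auto simp: i_def)
    have part_a: "part p k = a" if "k \<in> S" for k using that by (simp add: S_def part_def)
    have fi: "part p i = a" using row_seqs_mono[OF f, of "Min S" i] row_seqs_mono[OF f, of i j] i
        part_a[OF m(1)] part_a[OF j(1)] by simp
    have "a > 0" using a assms(1) by (auto simp: is_partition_def intro: gr0I)
    have "part p (Suc j) \<noteq> a"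
    proof
      assume "part p (Suc j) = a"
      then have "Suc j \<in> S" using \<open>a > 0\<close> by (auto simp: S_def part_def split: if_splits)
      then show False using j(2) by fastforce
    qed
    then have "part p (Suc j) < a" using row_seqs_Suc[OF f, of j] part_a[OF j(1)] by simp
    then have "bent l (part p)" unfolding bent_def
      using i fi part_a[OF j(1)] by (intro exI[of _ i] exI[of _ j]) simp
    then show False using assms(3) by simp
  qed
qed

text \<open>Removal sequences of partitions and of row sequences simulate each other through
  \<open>part\<close>. Regularity comes from \<open>regular_if_not_bent\<close>, as a good sequence
  is not bent.\<close>

lemma l_partition_iff:
  assumes "l \<ge> 2"
  shows "l_partition l p \<longleftrightarrow> is_partition p \<and> good l (part p)"
proof
  have l: "l > 0" using assms by simp
  {
    assume lp: "l_partition l p"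
    then have p: "is_partition p" by (simp add: l_partition_def regular_partition_def)
    have "\<exists>q. is_partition q \<and> part q = g \<and> (remove_horizontal l)\<^sup>*\<^sup>* p q"
      if "(step l)\<^sup>*\<^sup>* (part p) g" for g
      using that
    proof (induction rule: rtranclp_induct)
      case base
      then show ?case using p by blast
    next
      case (step g h)
      then obtain q where q: "is_partition q" "part q = g" "(remove_horizontal l)\<^sup>*\<^sup>* p q" by blast
      then have "h \<in> row_seqs" using row_seqs_step step(2) part_in_row_seqs by blast
      then obtain r where r: "is_partition r" "part r = h" using row_seq_obtains_partition by blast
      then have "remove_horizontal l q r"
        using step_imp_remove_horizontal[OF r(1) l] step(2) q by blast
      then show ?case using r q(3) by (metis rtranclp.rtrancl_into_rtrancl)
    qed
    then have "good l (part p)"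
      using lp bent_imp_nonhorizontal_rim_hook unfolding good_def l_partition_def by metis
    then show "is_partition p \<and> good l (part p)" using p by simp
  }
  assume p: "is_partition p \<and> good l (part p)"
  have "is_partition q \<and> (step l)\<^sup>*\<^sup>* (part p) (part q)" if "(remove_horizontal l)\<^sup>*\<^sup>* p q" for q
    using that
  proof (induction rule: rtranclp_induct)
    case base
    then show ?case using p by simp
  next
    case (step q r)
    then have "is_partition r" by (auto simp: remove_horizontal_def rim_hook_removal_def)
    moreover have "step l (part q) (part r)" using remove_horizontal_imp_step step l by blast
    ultimately show ?case using step.IH by (metis rtranclp.rtrancl_into_rtrancl)
  qed
  then show "l_partition l p"
    using p regular_if_not_bent[OF _ assms] nonhorizontal_rim_hook_imp_bent good_not_bent
    unfolding l_partition_def good_def by blast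
qed

lemma num_l_partitions_eq:
  assumes "l \<ge> 2"
  shows "num_l_partitions l k = card (goods l k)"
proof -
  have "goods l k = part ` {p. l_partition l p \<and> first_part p = k}"
    using bij_betw_imp_surj_on[OF bij_betw_part]
    by (auto simp: l_partition_iff[OF assms] first_part_eq)
  moreover have "inj_on part {p. l_partition l p \<and> first_part p = k}"
    by (rule inj_on_subset[OF bij_betw_imp_inj_on[OF bij_betw_part]])
      (auto simp: l_partition_iff[OF assms])
  ultimately show ?thesis by (simp add: num_l_partitions_def card_image)
qed

section \<open>The generating function\<close>

theorem theorem2p3p3p1:
  fixes l :: nat
  assumes "l \<ge> 2"
  shows "l_partition_fps l =
    (1 - fps_X ^ (l - 1)) / ((1 - fps_X) ^ (l - 1) * (1 - fps_X ^ (l - 1) - fps_X ^ l))"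
proof -
  have l: "l > 1" using assms by simp
  define C D :: "rat fps" where "C = Abs_fps (\<lambda>k. of_nat (card (cores l k)))"
    and "D = Abs_fps (\<lambda>k. of_nat (card (small_cores l k)))"
  let ?B = "l_partition_fps l" and ?U = "(1 - fps_X) ^ (l - 1) :: rat fps"
  let ?V = "1 - fps_X ^ (l - 1) - fps_X ^ l :: rat fps"
  have "C = fps_X ^ (l - 1) * C + D"
  proof (rule fps_ext)
    fix k
    have "card (cores l k) = (if k \<ge> l - 1 then card (cores l (k - (l - 1))) else 0) + card (small_cores l k)"
      using assms finite_cores by (intro cores_recursion) auto
    then show "fps_nth C k = fps_nth (fps_X ^ (l - 1) * C + D) k"
      by (simp only: C_def D_def fps_add_nth fps_X_power_mult_nth fps_nth_Abs_fps of_nat_add) auto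
  qed
  then have D: "D = (1 - fps_X ^ (l - 1)) * C" by (simp add: algebra_simps)
  have "?B = fps_X ^ l * ?B + fps_X ^ (l - 1) * ?B + D"
  proof (rule fps_ext)
    fix k
    have "card (goods l k) = (if k \<ge> l then card (goods l (k - l)) else 0) +
        (if k \<ge> l - 1 then card (goods l (k - (l - 1))) else 0) + card (small_cores l k)"
      using goods_recursion[OF l finite_cores[OF l]] by blast
    then show "fps_nth ?B k = fps_nth (fps_X ^ l * ?B + fps_X ^ (l - 1) * ?B + D) k"
      by (simp only: l_partition_fps_def num_l_partitions_eq[OF assms] D_def fps_add_nth fps_X_power_mult_nth fps_nth_Abs_fps of_nat_add) auto
  qed
  then have B: "?B * ?V = D" by (simp add: algebra_simps)
  \<comment> \<open>The binomial coefficients counting cores are those of the negative binomial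
    series.\<close>
  have "C = inverse ?U"
    using one_minus_const_fps_X_neg_power'[of "l - 1" "1 :: rat"] card_cores[OF l] l
    by (simp add: C_def)
  moreover have U0: "fps_nth ?U 0 \<noteq> 0" by (simp add: fps_power_zeroth)
  ultimately have CU: "C * ?U = 1" using inverse_mult_eq_1 by blast
  have "?B * (?U * ?V) = (?B * ?V) * ?U" by (simp only: ac_simps)
  also have "\<dots> = (1 - fps_X ^ (l - 1)) * (C * ?U)" by (simp only: B D mult.assoc)
  also have "\<dots> = 1 - fps_X ^ (l - 1)" by (simp only: CU mult_1_right)
  finally have "?B * (?U * ?V) = 1 - fps_X ^ (l - 1)" .
  \<comment> \<open>Since \<open>l \<ge> 2\<close>, both powers of \<open>fps_X\<close> in
    \<open>?V\<close> have constant term \<open>0\<close>; hence the denominator is nonzero and may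
    be cancelled.\<close>
  moreover have "fps_nth (?U * ?V) 0 \<noteq> 0" using U0 assms by simp
  then have "?U * ?V \<noteq> 0" by (metis fps_zero_nth)
  ultimately show ?thesis using nonzero_mult_div_cancel_right[of "?U * ?V" ?B] by metis
qed

end
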